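(* For every integer $n\ge 5$, the graph $P(n,2)$ is not an Italian graph.
   Context: $P(n,k)$ (with $n\ge 3$, $1\le k<n/2$) denotes the generalized Petersen graph: the 3-regular simple graph on the $2n$ vertices $v_0,v_1,\dots,v_{2n-1}$ (subscripts read modulo $2n$) with edges $v_{2i}v_{2i+2}$, $v_{2i}v_{2i+1}$ and $v_{2i+1}v_{2i+1+2k}$ for $0\le i\le n-1$. For a graph $G=(V,E)$, an Italian dominating function (IDF) of $G$ is a function $f:V\to\{0,1,2\}$ such that every $v\in V$ with $f(v)=0$ satisfies $\sum_{u\in N(v)}f(u)\ge 2$, where $N(v)$ is the open neighborhood of $v$. Its weight is $w(f)=\sum_{v\in V}f(v)$, and the Italian domination number is $\gamma_I(G)=\min_f w(f)$ over all IDFs $f$ of $G$. The domination number $\gamma(G)$ is the minimum cardinality of a set $D\subseteq V$ such that every vertex of $G$ is in $D$ or adjacent to a vertex of $D$. A graph $G$ is called an Italian graph if $\gamma_I(G)=2\gamma(G)$. *)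

theory Defs
  imports "Graph_Theory.Pair_Digraph"
begin

text \<open>
  Finite simple graphs are the \<^locale>\<open>pair_graph\<close>s of Graph_Theory: finite vertex set,
  and a symmetric irreflexive arc relation (each undirected edge is a pair of opposite arcs).
  The definitions below are stated for arbitrary \<^typ>\<open>'a pair_pre_digraph\<close>s but are
  meant for such graphs only.
\<close>

definition open_nbhd :: "'a pair_pre_digraph \<Rightarrow> 'a \<Rightarrow> 'a set" where
  "open_nbhd G v = {u. v \<rightarrow>\<^bsub>with_proj G\<^esub> u}"

definition italian_dominating_fun :: "'a pair_pre_digraph \<Rightarrow> ('a \<Rightarrow> nat) \<Rightarrow> bool" where
  "italian_dominating_fun G f \<longleftrightarrow>
     (\<forall>v\<in>pverts G. f v \<in> {0, 1, 2}) \<and>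
     (\<forall>v\<in>pverts G. f v = 0 \<longrightarrow> (\<Sum>u\<in>open_nbhd G v. f u) \<ge> 2)"

definition weight :: "'a pair_pre_digraph \<Rightarrow> ('a \<Rightarrow> nat) \<Rightarrow> nat" where
  "weight G f = (\<Sum>v\<in>pverts G. f v)"

definition italian_domination_number :: "'a pair_pre_digraph \<Rightarrow> nat" where
  "italian_domination_number G = (LEAST w. \<exists>f. italian_dominating_fun G f \<and> weight G f = w)"

definition dominating_set :: "'a pair_pre_digraph \<Rightarrow> 'a set \<Rightarrow> bool" where
  "dominating_set G D \<longleftrightarrow>
     D \<subseteq> pverts G \<and> (\<forall>v\<in>pverts G. v \<in> D \<or> (\<exists>u\<in>D. v \<rightarrow>\<^bsub>with_proj G\<^esub> u))"

definition domination_number :: "'a pair_pre_digraph \<Rightarrow> nat" where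
  "domination_number G = (LEAST m. \<exists>D. dominating_set G D \<and> card D = m)"

definition italian_graph :: "'a pair_pre_digraph \<Rightarrow> bool" where
  "italian_graph G \<longleftrightarrow> italian_domination_number G = 2 * domination_number G"

text \<open>The minima are over nonempty sets, hence attained.\<close>

lemma italian_domination_number_attained:
  "\<exists>f. italian_dominating_fun G f \<and> weight G f = italian_domination_number G"
proof -
  have "italian_dominating_fun G (\<lambda>_. 2)"
    by (simp add: italian_dominating_fun_def)
  then show ?thesis
    unfolding italian_domination_number_def
    by (intro LeastI_ex[where P = "\<lambda>w. \<exists>f. italian_dominating_fun G f \<and> weight G f = w"]) blast
qed

lemma domination_number_attained:
  "\<exists>D. dominating_set G D \<and> card D = domination_number G"
proof -
  have "dominating_set G (pverts G)"
    by (simp add: dominating_set_def)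
  then show ?thesis
    unfolding domination_number_def
    by (intro LeastI_ex[where P = "\<lambda>m. \<exists>D. dominating_set G D \<and> card D = m"]) blast
qed

text \<open>
  \<open>gen_petersen n k\<close> is \<open>P(n,k)\<close>, with the vertex \<open>v\<^sub>j\<close> represented by
  the number \<open>j < 2 * n\<close>. It is meant for \<open>n \<ge> 3\<close> and \<open>1 \<le> k < n / 2\<close>.
\<close>

definition gen_petersen_edges :: "nat \<Rightarrow> nat \<Rightarrow> nat rel" where
  "gen_petersen_edges n k =
     {(2 * i, (2 * i + 2) mod (2 * n)) | i. i < n} \<union>
     {(2 * i, 2 * i + 1) | i. i < n} \<union>
     {(2 * i + 1, (2 * i + 1 + 2 * k) mod (2 * n)) | i. i < n}"

definition gen_petersen :: "nat \<Rightarrow> nat \<Rightarrow> nat pair_pre_digraph" where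
  "gen_petersen n k =
     \<lparr> pverts = {..<2 * n}, parcs = gen_petersen_edges n k \<union> (gen_petersen_edges n k)\<inverse> \<rparr>"

lemma mod_shift_neq:
  fixes a d m :: nat
  assumes "a < m" "0 < d" "d < m"
  shows "(a + d) mod m \<noteq> a"
  using assms by (cases "a + d < m") (auto simp: mod_if)

lemma pair_graph_gen_petersen:
  assumes "n \<ge> 3" "1 \<le> k" "2 * k < n"
  shows "pair_graph (gen_petersen n k)"
proof -
  have sub: "gen_petersen_edges n k \<subseteq> {..<2 * n} \<times> {..<2 * n}"
    using assms unfolding gen_petersen_edges_def by auto
  have irr: "a \<noteq> b" if "(a, b) \<in> gen_petersen_edges n k" for a b
  proof -
    from that consider i where "i < n" "a = 2 * i" "b = (a + 2) mod (2 * n)"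
      | i where "i < n" "a = 2 * i" "b = a + 1"
      | i where "i < n" "a = 2 * i + 1" "b = (a + 2 * k) mod (2 * n)"
      unfolding gen_petersen_edges_def by blast
    then show ?thesis
    proof cases
      case 1
      then show ?thesis using mod_shift_neq[of a "2 * n" 2] assms by simp
    next
      case 2
      then show ?thesis by simp
    next
      case 3
      then show ?thesis using mod_shift_neq[of a "2 * n" "2 * k"] assms by simp
    qed
  qed
  show ?thesis
  proof unfold_locales
    fix e assume e: "e \<in> parcs (gen_petersen n k)"
    then show "fst e \<in> pverts (gen_petersen n k)" "snd e \<in> pverts (gen_petersen n k)"
      using sub by (auto simp: gen_petersen_def)
    from e show "fst e \<noteq> snd e"
      using irr by (cases e) (auto simp: gen_petersen_def)
  next
    show "finite (pverts (gen_petersen n k))" by (simp add: gen_petersen_def)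
    have "finite (gen_petersen_edges n k)" using sub by (rule finite_subset) simp
    then show "finite (parcs (gen_petersen n k))" by (simp add: gen_petersen_def)
    show "symmetric (with_proj (gen_petersen n k))"
      by (auto simp: symmetric_def gen_petersen_def sym_def)
  qed
qed

end

theory Submission
  imports Defs
begin

text \<open>
  Split the vertices of \<open>P(n,k)\<close> into the outer layer (even numbers) and the inner layer (odd
  numbers), each of size \<open>n\<close>. A vertex dominates three vertices of its own layer (itself included)
  and one of the other. So a dominating set with \<open>a\<close> outer and \<open>b\<close> inner vertices satisfies
  \<open>n \<le> 3a + b\<close> and \<open>n \<le> a + 3b\<close> (lemma \<open>dominating_set_layer_bounds\<close>), whence
  \<open>2\<gamma> \<ge> n\<close>. On the other hand \<open>P(n,2)\<close> has an Italian dominating function of weight roughly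
  \<open>4n/5\<close>, namely a 0-1 pattern that repeats every five spokes (lemmas \<open>italian_pattern\<close> and
  \<open>weight_pattern\<close>). Hence \<open>\<gamma>\<^sub>I < 2\<gamma>\<close> as soon as \<open>n\<close> is large. For small \<open>n\<close> the rounding
  matters: \<open>n = 7\<close> needs that \<open>2\<gamma>\<close> is even, and \<open>n = 6\<close> needs both
  layer inequalities, which exclude \<open>a + b = 3\<close> since each of \<open>a\<close>, \<open>b\<close> must be at least 2.
\<close>

lemma mem_open_nbhd_gen_petersen:
  "u \<in> open_nbhd (gen_petersen n k) v \<longleftrightarrow>
     (v, u) \<in> gen_petersen_edges n k \<or> (u, v) \<in> gen_petersen_edges n k"
  by (auto simp: open_nbhd_def gen_petersen_def)

lemma mod_shift_inverse:
  fixes s m u :: nat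
  assumes "u < m" "s \<le> m"
  shows "u = ((u + s) mod m + (m - s)) mod m"
proof -
  have "((u + s) mod m + (m - s)) mod m = (u + s + (m - s)) mod m"
    by (simp add: mod_add_left_eq)
  also have "\<dots> = u"
    using assms by simp
  finally show ?thesis by simp
qed

lemma edge_cases:
  assumes "(x, y) \<in> gen_petersen_edges n k" "1 \<le> k" "k \<le> n"
  obtains (outer) "even x" "even y" "y = (x + 2) mod (2 * n)" "x = (y + (2 * n - 2)) mod (2 * n)"
  | (spoke) "even x" "y = x + 1"
  | (inner) "odd x" "odd y" "y = (x + 2 * k) mod (2 * n)" "x = (y + (2 * n - 2 * k)) mod (2 * n)"
proof -
  from assms(1) consider
      i where "i < n" "x = 2 * i" "y = (x + 2) mod (2 * n)"
    | i where "i < n" "x = 2 * i" "y = x + 1"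
    | i where "i < n" "x = 2 * i + 1" "y = (x + 2 * k) mod (2 * n)"
    unfolding gen_petersen_edges_def by blast
  then show thesis
  proof cases
    case 1
    then have "even x" "even y" by (simp_all add: dvd_mod_iff)
    moreover have "x = (y + (2 * n - 2)) mod (2 * n)"
      unfolding 1(3) using 1(1,2) by (intro mod_shift_inverse) auto
    ultimately show thesis
      using 1(3) outer by blast
  next
    case 2
    then show thesis by (intro spoke) auto
  next
    case 3
    have "odd x" "odd y" using 3 by (simp_all add: dvd_mod_iff)
    moreover have "x = (y + (2 * n - 2 * k)) mod (2 * n)"
      unfolding 3(3) using 3(1,2) assms(3) by (intro mod_shift_inverse) auto
    ultimately show thesis
      using 3(3) inner by blast
  qed
qed

lemma card_le_weighted_cover:
  assumes "finite A" "finite B" "X \<subseteq> (\<Union>d\<in>A. F d) \<union> (\<Union>d\<in>B. H d)"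
    and "\<And>d. d \<in> A \<Longrightarrow> finite (F d) \<and> card (F d) \<le> p"
    and "\<And>d. d \<in> B \<Longrightarrow> finite (H d) \<and> card (H d) \<le> q"
  shows "card X \<le> p * card A + q * card B"
proof -
  have "card X \<le> card ((\<Union>d\<in>A. F d) \<union> (\<Union>d\<in>B. H d))"
    using assms by (intro card_mono) auto
  also have "\<dots> \<le> card (\<Union>d\<in>A. F d) + card (\<Union>d\<in>B. H d)"
    by (rule card_Un_le)
  also have "\<dots> \<le> (\<Sum>d\<in>A. card (F d)) + (\<Sum>d\<in>B. card (H d))"
    using assms(1,2) by (intro add_mono card_UN_le)
  also have "\<dots> \<le> (\<Sum>d\<in>A. p) + (\<Sum>d\<in>B. q)"
    using assms(4,5) by (intro add_mono sum_mono) auto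
  finally show ?thesis by (simp add: mult.commute)
qed

text \<open>
  Counting the outer layer gives the first inequality: it is covered by the triples of consecutive
  outer vertices around the outer members of \<open>D\<close> and the spoke ends of the inner ones. The inner
  layer gives the second.
\<close>

lemma dominating_set_layer_bounds:
  assumes D: "dominating_set (gen_petersen n k) D" and k: "1 \<le> k" "k \<le> n"
  obtains a b where "card D = a + b" "n \<le> 3 * a + b" "n \<le> a + 3 * b"
proof -
  let ?A = "{d \<in> D. even d}" and ?B = "{d \<in> D. odd d}"
  let ?T = "\<lambda>s d. {d, (d + s) mod (2 * n), (d + (2 * n - s)) mod (2 * n)}"
  have fin: "finite D"
    using D by (auto simp: dominating_set_def gen_petersen_def intro: finite_subset)
  have near: "v \<in> D \<or> (\<exists>d\<in>D. (v, d) \<in> gen_petersen_edges n k \<or> (d, v) \<in> gen_petersen_edges n k)"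
    if "v < 2 * n" for v
    using D that mem_open_nbhd_gen_petersen[of _ n k v]
    by (auto simp: dominating_set_def open_nbhd_def gen_petersen_def)
  have T: "card (?T s d) \<le> 3" for s d
    by (simp add: card_insert_if)
  have outer: "v \<in> (\<Union>d\<in>?A. ?T 2 d) \<union> (\<Union>d\<in>?B. {d - 1})" if v: "v < 2 * n" "even v" for v
    using near[OF v(1)]
  proof (elim disjE bexE)
    fix d assume "d \<in> D" "(v, d) \<in> gen_petersen_edges n k"
    from this(2) k show ?thesis
    proof (cases rule: edge_cases)
      case spoke
      then show ?thesis using \<open>d \<in> D\<close> v by auto
    qed (use \<open>d \<in> D\<close> v in blast)+
  next
    fix d assume "d \<in> D" "(d, v) \<in> gen_petersen_edges n k"
    from this(2) k show ?thesis
    proof (cases rule: edge_cases)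
      case spoke
      then show ?thesis using \<open>d \<in> D\<close> v by auto
    qed (use \<open>d \<in> D\<close> v in blast)+
  qed (use v in auto)
  have inner: "v \<in> (\<Union>d\<in>?A. {d + 1}) \<union> (\<Union>d\<in>?B. ?T (2 * k) d)" if v: "v < 2 * n" "odd v" for v
    using near[OF v(1)]
  proof (elim disjE bexE)
    fix d assume "d \<in> D" "(v, d) \<in> gen_petersen_edges n k"
    from this(2) k show ?thesis
    proof (cases rule: edge_cases)
      case spoke
      then show ?thesis using \<open>d \<in> D\<close> v by auto
    qed (use \<open>d \<in> D\<close> v in blast)+
  next
    fix d assume "d \<in> D" "(d, v) \<in> gen_petersen_edges n k"
    from this(2) k show ?thesis
    proof (cases rule: edge_cases)
      case spoke
      then show ?thesis using \<open>d \<in> D\<close> v by auto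
    qed (use \<open>d \<in> D\<close> v in blast)+
  qed (use v in auto)
  have "(\<lambda>i. 2 * i) ` {..<n} \<subseteq> (\<Union>d\<in>?A. ?T 2 d) \<union> (\<Union>d\<in>?B. {d - 1})"
    by (intro image_subsetI outer) simp_all
  then have "card ((\<lambda>i. 2 * i) ` {..<n}) \<le> 3 * card ?A + 1 * card ?B"
    by (rule card_le_weighted_cover[rotated 2]) (use fin T in \<open>simp_all del: add_2_eq_Suc'\<close>)
  moreover have "(\<lambda>i. 2 * i + 1) ` {..<n} \<subseteq> (\<Union>d\<in>?A. {d + 1}) \<union> (\<Union>d\<in>?B. ?T (2 * k) d)"
    by (intro image_subsetI inner) simp_all
  then have "card ((\<lambda>i. 2 * i + 1) ` {..<n}) \<le> 1 * card ?A + 3 * card ?B"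
    by (rule card_le_weighted_cover[rotated 2]) (use fin T in \<open>simp_all del: add_2_eq_Suc'\<close>)
  moreover have "card D = card ?A + card ?B"
    using fin by (subst card_Un_disjoint[symmetric]) (auto intro: arg_cong[where f = card])
  ultimately show thesis
    by (intro that[of "card ?A" "card ?B"]) (simp_all add: card_image inj_on_def)
qed

text \<open>
  In every block of five spokes, the outer vertices of spokes 0 and 3 and the inner vertices of
  spokes 1 and 2 get the value 1. When \<open>n \<equiv> 1, 2 (mod 5)\<close> the pattern does not close up
  around the cycle, which the additional vertex 1 repairs.
\<close>

definition pattern :: "nat \<Rightarrow> nat \<Rightarrow> nat" where
  "pattern n j = (if j mod 10 \<in> {0, 3, 5, 6} \<or> j = 1 \<and> n mod 5 \<in> {1, 2} then 1 else 0)"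

lemma sum_nbhd_ge_2:
  assumes "finite (open_nbhd G v)" "x \<in> open_nbhd G v" "y \<in> open_nbhd G v" "x \<noteq> y"
    and "f x = 1" "f y = (1::nat)"
  shows "(\<Sum>u\<in>open_nbhd G v. f u) \<ge> 2"
proof -
  have "(\<Sum>u\<in>{x, y}. f u) \<le> (\<Sum>u\<in>open_nbhd G v. f u)"
    using assms by (intro sum_mono2) auto
  then show ?thesis using assms by simp
qed

lemma outer_edge: "even j \<Longrightarrow> j < 2 * n \<Longrightarrow> (j, (j + 2) mod (2 * n)) \<in> gen_petersen_edges n k"
  by (auto simp: gen_petersen_edges_def elim!: evenE)

lemma spoke_edge: "even j \<Longrightarrow> j < 2 * n \<Longrightarrow> (j, j + 1) \<in> gen_petersen_edges n k"
  by (auto simp: gen_petersen_edges_def elim!: evenE)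

lemma inner_edge:
  "odd j \<Longrightarrow> j < 2 * n \<Longrightarrow> (j, (j + 2 * k) mod (2 * n)) \<in> gen_petersen_edges n k"
  by (auto simp: gen_petersen_edges_def elim!: oddE)

text \<open>
  A vertex of value 0 is \<open>10 p + t\<close> with \<open>t\<close> in \<open>{1, 2, 4, 7, 8, 9}\<close>, and has two
  neighbours of value 1. Of the shifts used, only forward ones can leave the range, and the cases
  below check that they then land on one of the vertices 0, 1, 3 of value 1.
\<close>

lemma italian_pattern:
  assumes n: "n \<ge> 5"
  shows "italian_dominating_fun (gen_petersen n 2) (pattern n)"
  unfolding italian_dominating_fun_def
proof (intro conjI ballI impI)
  fix v show "pattern n v \<in> {0, 1, 2}" by (simp add: pattern_def)
next
  fix v assume "v \<in> pverts (gen_petersen n 2)" and zero: "pattern n v = 0"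
  then have v: "v < 2 * n" by (simp add: gen_petersen_def)
  let ?N = "open_nbhd (gen_petersen n 2) v" and ?m = "2 * n"
  have fin: "finite ?N"
  proof -
    interpret pair_graph "gen_petersen n 2"
      using n by (intro pair_graph_gen_petersen) auto
    show ?thesis
      by (rule finite_subset[of _ "pverts (gen_petersen n 2)"])
         (auto simp: open_nbhd_def dest: wellformed)
  qed
  have outer_fwd: "even v \<Longrightarrow> (v + 2) mod ?m \<in> ?N"
    and spoke_fwd: "even v \<Longrightarrow> v + 1 \<in> ?N"
    and inner_fwd: "odd v \<Longrightarrow> (v + 4) mod ?m \<in> ?N"
    using outer_edge[OF _ v] spoke_edge[OF _ v] inner_edge[OF _ v, of 2]
    by (auto simp: mem_open_nbhd_gen_petersen)
  have outer_back: "even v \<Longrightarrow> v \<ge> 2 \<Longrightarrow> v - 2 \<in> ?N"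
    and spoke_back: "odd v \<Longrightarrow> v - 1 \<in> ?N"
    and inner_back: "odd v \<Longrightarrow> v \<ge> 4 \<Longrightarrow> v - 4 \<in> ?N"
    using v outer_edge[of "v - 2" n 2] spoke_edge[of "v - 1" n 2] inner_edge[of "v - 4" n 2]
    by (simp_all add: mem_open_nbhd_gen_petersen odd_pos del: add_2_eq_Suc')
  have odd_y: "odd v \<Longrightarrow> odd ((v + 4) mod ?m)"
    by (simp add: dvd_mod_iff)
  obtain p t where vp: "v = 10 * p + t" and t: "t < 10"
    using mod_less_divisor[of 10 v] by (metis mult_div_mod_eq zero_less_numeral)
  have "t \<notin> {0, 3, 5, 6}"
    using zero t vp by (auto simp: pattern_def split: if_splits)
  then have "t \<in> {1, 2, 4, 7, 8, 9}"
    using t by simp presburger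
  then have "\<exists>x y. x \<in> ?N \<and> y \<in> ?N \<and> x \<noteq> y \<and> pattern n x = 1 \<and> pattern n y = 1"
  proof (elim insertE emptyE)
    assume t: "t = 1"
    let ?y = "(v + 4) mod ?m"
    have "odd v" using vp t by simp
    have "pattern n ?y = 1"
    proof (cases "v + 4 < ?m")
      case True
      then show ?thesis using vp t by (simp add: pattern_def mod_simps)
    next
      case False
      then have "n = 5 * p + 1 \<or> n = 5 * p + 2" using vp t v by presburger
      then show ?thesis
      proof
        assume "n = 5 * p + 1"
        then have "?y = 3" using vp t n by (simp add: mod_if)
        then show ?thesis by (simp add: pattern_def)
      next
        assume *: "n = 5 * p + 2"
        then have "?y = 1" using vp t n by (simp add: mod_if)
        moreover have "n mod 5 = 2" using * by presburger
        ultimately show ?thesis by (simp add: pattern_def)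
      qed
    qed
    moreover have "pattern n (v - 1) = 1" using vp t by (simp add: pattern_def)
    moreover have "v - 1 \<noteq> ?y" using odd_y \<open>odd v\<close>
      by (metis even_add odd_one odd_pos Suc_leI One_nat_def le_add_diff_inverse2)
    ultimately show ?thesis
      using spoke_back[OF \<open>odd v\<close>] inner_fwd[OF \<open>odd v\<close>] by blast
  next
    assume t: "t = 2"
    have "even v" "v \<ge> 2" using vp t by auto
    have "pattern n (v - 2) = 1" "pattern n (v + 1) = 1" using vp t by (auto simp: pattern_def)
    then show ?thesis
      using outer_back[OF \<open>even v\<close> \<open>v \<ge> 2\<close>] spoke_fwd[OF \<open>even v\<close>]
      by (intro exI[of _ "v - 2"] exI[of _ "v + 1"]) auto
  next
    assume t: "t = 4"
    have "even v" using vp t by auto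
    have "pattern n (v + 1) = 1" using vp t by (auto simp: pattern_def)
    moreover have "pattern n ((v + 2) mod ?m) = 1"
    proof (cases "v + 2 < ?m")
      case True
      then show ?thesis using vp t by (simp add: pattern_def)
    next
      case False
      then have "v + 2 = ?m" using v \<open>even v\<close> by presburger
      then show ?thesis by (simp add: pattern_def)
    qed
    moreover have "v + 1 \<noteq> (v + 2) mod ?m"
      using \<open>even v\<close> by (metis dvd_mod dvd_triv_left even_add even_plus_one_iff even_numeral)
    ultimately show ?thesis
      using spoke_fwd[OF \<open>even v\<close>] outer_fwd[OF \<open>even v\<close>] by blast
  next
    assume t: "t = 7"
    have "odd v" "v \<ge> 4" using vp t by auto
    have "v - 4 = 10 * p + 3" "v - 1 = 10 * p + 6" using vp t by auto
    then have "pattern n (v - 4) = 1" "pattern n (v - 1) = 1" "v - 4 \<noteq> v - 1"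
      by (auto simp: pattern_def)
    then show ?thesis
      using inner_back[OF \<open>odd v\<close> \<open>v \<ge> 4\<close>] spoke_back[OF \<open>odd v\<close>] by blast
  next
    assume t: "t = 8"
    have "even v" "v \<ge> 2" using vp t by auto
    have "v - 2 = 10 * p + 6" using vp t by simp
    then have "pattern n (v - 2) = 1" by (simp add: pattern_def)
    moreover have "pattern n ((v + 2) mod ?m) = 1 \<and> v - 2 \<noteq> (v + 2) mod ?m"
    proof (cases "v + 2 < ?m")
      case True
      then show ?thesis using vp t by (simp add: pattern_def mod_simps)
    next
      case False
      then have "v + 2 = ?m" using v \<open>even v\<close> by presburger
      then show ?thesis using vp t by (simp add: pattern_def)
    qed
    ultimately show ?thesis
      using outer_back[OF \<open>even v\<close> \<open>v \<ge> 2\<close>] outer_fwd[OF \<open>even v\<close>] by blast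
  next
    assume t: "t = 9"
    have "odd v" "v \<ge> 4" using vp t by auto
    have v4: "v - 4 = 10 * p + 5" using vp t by simp
    then have "pattern n (v - 4) = 1" by (simp add: pattern_def)
    moreover have "pattern n ((v + 4) mod ?m) = 1 \<and> v - 4 \<noteq> (v + 4) mod ?m"
    proof (cases "v + 4 < ?m")
      case True
      then show ?thesis using vp t by (simp add: pattern_def mod_simps)
    next
      case False
      then have "n = 5 * p + 5 \<or> n = 5 * p + 6" using vp t v by presburger
      then show ?thesis
      proof
        assume "n = 5 * p + 5"
        then have "(v + 4) mod ?m = 3" using vp t by (simp add: mod_if)
        then show ?thesis using v4 by (simp add: pattern_def)
      next
        assume *: "n = 5 * p + 6"
        then have "(v + 4) mod ?m = 1" using vp t by (simp add: mod_if)
        moreover have "n mod 5 = 1" using * by presburger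
        ultimately show ?thesis using v4 by (simp add: pattern_def)
      qed
    qed
    ultimately show ?thesis
      using inner_back[OF \<open>odd v\<close> \<open>v \<ge> 4\<close>] inner_fwd[OF \<open>odd v\<close>] by blast
  qed
  then show "(\<Sum>u\<in>?N. pattern n u) \<ge> 2"
    using sum_nbhd_ge_2[OF fin] by blast
qed

lemma sum_mod_periodic:
  fixes g :: "nat \<Rightarrow> nat"
  shows "(\<Sum>j<c * q + s. g (j mod c)) = q * (\<Sum>j<c. g (j mod c)) + (\<Sum>j<s. g (j mod c))"
proof (induction q)
  case (Suc q)
  have "(\<Sum>j<c + m. g (j mod c)) = (\<Sum>j<c. g (j mod c)) + (\<Sum>j<m. g (j mod c))" for m
    by (induction m) (simp_all add: add.assoc)
  from this[of "c * q + s"] show ?case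
    using Suc by (simp add: algebra_simps)
qed simp

text \<open>
  The entry \<open>r\<close> of the list is the total of the last \<open>r\<close> spokes, which carry the first
  \<open>r\<close> columns of the pattern, plus 1 for the repair when \<open>r\<close> is 1 or 2.
\<close>

lemma weight_pattern:
  assumes "r < 5"
  shows "weight (gen_petersen (5 * q + r) 2) (pattern (5 * q + r)) \<le> 4 * q + [0, 2, 3, 3, 4] ! r"
proof -
  let ?n = "5 * q + r"
  let ?g = "\<lambda>t::nat. if t \<in> {0, 3, 5, 6} then 1 else 0 :: nat"
  let ?e = "if r \<in> {1, 2} then 1 else 0 :: nat"
  have "weight (gen_petersen ?n 2) (pattern ?n) = (\<Sum>j<2 * ?n. pattern ?n j)"
    by (simp add: weight_def gen_petersen_def)
  also have "\<dots> \<le> (\<Sum>j<2 * ?n. ?g (j mod 10) + (if j = 1 then ?e else 0))"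
    using assms by (intro sum_mono) (auto simp: pattern_def)
  also have "\<dots> \<le> (\<Sum>j<10 * q + 2 * r. ?g (j mod 10)) + ?e"
    by (simp only: sum.distrib sum.delta finite_lessThan) (simp add: algebra_simps)
  also have "(\<Sum>j<10 * q + 2 * r. ?g (j mod 10))
      = q * (\<Sum>j<10. ?g (j mod 10)) + (\<Sum>j<2 * r. ?g (j mod 10))"
    by (rule sum_mod_periodic)
  also have "(\<Sum>j<10. ?g (j mod 10)) = 4"
    by (simp add: lessThan_nat_numeral)
  also have "q * 4 + (\<Sum>j<2 * r. ?g (j mod 10)) + ?e = 4 * q + [0, 2, 3, 3, 4] ! r"
  proof -
    have "r \<in> {0, 1, 2, 3, 4}" using assms by auto
    then show ?thesis
      by (elim insertE emptyE) (simp_all add: lessThan_nat_numeral)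
  qed
  finally show ?thesis by simp
qed

theorem mainTheorem7:
  fixes n :: nat
  assumes "n \<ge> 5"
  shows "\<not> italian_graph (gen_petersen n 2)"
proof
  assume eq: "italian_graph (gen_petersen n 2)"
  obtain D where D: "dominating_set (gen_petersen n 2) D"
    "card D = domination_number (gen_petersen n 2)"
    using domination_number_attained by blast
  obtain a b where ab: "card D = a + b" "n \<le> 3 * a + b" "n \<le> a + 3 * b"
    by (rule dominating_set_layer_bounds[OF D(1)]) (use assms in simp_all)
  define q r where "q = n div 5" and "r = n mod 5"
  have n: "n = 5 * q + r" and r: "r < 5" and q: "q \<ge> 1"
    using assms by (auto simp: q_def r_def)
  have "italian_domination_number (gen_petersen n 2) \<le> weight (gen_petersen n 2) (pattern n)"
    unfolding italian_domination_number_def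
    using italian_pattern[OF assms] by (intro Least_le) blast
  also have "\<dots> \<le> 4 * q + [0, 2, 3, 3, 4] ! r"
    using weight_pattern[OF r, of q] n by simp
  finally have le: "2 * (a + b) \<le> 4 * q + [0, 2, 3, 3, 4] ! r"
    using eq D(2) ab(1) by (simp add: italian_graph_def)
  have ge: "2 * (a + b) \<ge> n"
    using ab(2,3) by arith
  then have gap: "q + r \<le> [0, 2, 3, 3, 4] ! r"
    using le n by linarith
  have "r \<in> {0, 1, 2, 3, 4}" using r by auto
  then have "q = 1 \<and> (r = 1 \<or> r = 2)"
    using gap q by auto
  then consider "n = 6" "2 * (a + b) \<le> 6" | "n = 7" "2 * (a + b) \<le> 7"
    using le n by auto
  then show False
  proof cases
    case 1
    then have "a + b \<le> 3" by simp
    then have "a \<ge> 2" "b \<ge> 2" using ab(2,3) \<open>n = 6\<close> by linarith+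
    then show False using \<open>a + b \<le> 3\<close> by simp
  next
    case 2
    then have "a + b \<le> 3" by presburger
    then show False using ge \<open>n = 7\<close> by simp
  qed
qed

end
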